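(* For every non-negative integer $m$, \begin{align*} \sum_{n=1}^\infty n\binom{2n+1}{2m}\Big(\frac59\Big)^n&=\frac{9}{16}\Big(\frac54\Big)^m\big((6m+3)F_{4m+4}-4F_{4m+2}\big),\\ \sum_{n=1}^\infty n\binom{2n+1}{2m+1}\Big(\frac59\Big)^n&=\frac{9}{32}\Big(\frac54\Big)^m\big((6m+6)L_{4m+6}-4L_{4m+4}\big),\\ \sum_{n=1}^\infty n\binom{2n}{2m}\Big(\frac59\Big)^n&=\frac{3}{16}\Big(\frac54\Big)^m\big((6m+3)L_{4m+4}-2L_{4m+2}\big),\\ \sum_{n=1}^\infty n\binom{2n}{2m+1}\Big(\frac59\Big)^n&=\frac{15}{16}\Big(\frac54\Big)^m\big((3m+3)F_{4m+6}-F_{4m+4}\big). \end{align*}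
   Context: $F_n$ and $L_n$ are the Fibonacci and Lucas numbers ($F_0=0,F_1=1$, $L_0=2,L_1=1$, both satisfying $X_n=X_{n-1}+X_{n-2}$). Binomial coefficients $\binom{N}{j}$ vanish when $j>N$. *)

theory Defs
  imports Complex_Main "HOL-Number_Theory.Fib"
begin

fun lucas :: "nat \<Rightarrow> nat" where
  "lucas 0 = 2"
| "lucas (Suc 0) = 1"
| "lucas (Suc (Suc n)) = lucas (Suc n) + lucas n"

end

theory Submission
  imports Defs
begin

text \<open>
  The generating function \<open>(\<Sum>n. (n choose j) * x ^ n) = x ^ j / (1 - x) ^ (j + 1)\<close> yields the
  sums weighted by a linear function of \<open>n\<close>. Averaging over \<open>x\<close> and \<open>- x\<close> isolates the even or
  odd \<open>n\<close>. At \<open>x = sqrt 5 / 3\<close>, where \<open>x\<^sup>2 = 5 / 9\<close>, the denominators are powers of the golden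
  ratio and its conjugate, since \<open>1 / (1 - x) = 3 / 2 * \<phi>\<^sup>2\<close> and \<open>1 / (1 + x) = 3 / 2 * \<psi>\<^sup>2\<close>;
  Binet's formulas convert these back to Fibonacci and Lucas numbers.
\<close>

text \<open>Multiplying by the geometric series adds a factor \<open>1 / (1 - x)\<close> and turns
  the coefficients into partial sums of column \<open>j\<close>; by the hockey-stick identity these
  are entries of column \<open>j + 1\<close>, shifted by one index, which a further factor
  \<open>x\<close> repairs.\<close>

lemma binomial_column_sums:
  fixes x :: real
  assumes "\<bar>x\<bar> < 1"
  shows "(\<lambda>n. real (n choose j) * x ^ n) sums (x ^ j / (1 - x) ^ (j + 1))"
  using assms
proof (induction j arbitrary: x)
  case 0
  then show ?case using geometric_sums[of x] by simp
next
  case (Suc j)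
  \<comment> \<open>The Cauchy product needs absolute convergence; it comes from the induction
    hypothesis at \<open>\<bar>x\<bar>\<close>, hence the induction with \<open>x\<close>
    arbitrary.\<close>
  have norm_sum: "summable (\<lambda>n. norm (real (n choose j) * x ^ n))"
    using sums_summable[OF Suc.IH[of "\<bar>x\<bar>"]] Suc.prems by (simp add: abs_mult power_abs)
  have norm_geo: "summable (\<lambda>n. norm (x ^ n))"
    using Suc.prems by (simp add: power_abs summable_geometric)
  have "(\<lambda>n. \<Sum>i\<le>n. real (i choose j) * x ^ i * x ^ (n - i)) sums
      ((\<Sum>n. real (n choose j) * x ^ n) * (\<Sum>n. x ^ n))"
    by (rule Cauchy_product_sums[OF norm_sum norm_geo])
  moreover have "(\<Sum>i\<le>n. real (i choose j) * x ^ i * x ^ (n - i)) =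
      real (Suc n choose Suc j) * x ^ n" for n
  proof -
    have "(\<Sum>i\<le>n. real (i choose j) * x ^ i * x ^ (n - i)) = (\<Sum>i\<le>n. real (i choose j) * x ^ n)"
      by (intro sum.cong refl) (simp add: mult.assoc flip: power_add)
    also have "\<dots> = real (\<Sum>i\<le>n. i choose j) * x ^ n"
      by (simp add: sum_distrib_right)
    finally show ?thesis unfolding sum_choose_upper .
  qed
  moreover have "(\<Sum>n. real (n choose j) * x ^ n) = x ^ j / (1 - x) ^ (j + 1)"
    using Suc.IH[OF Suc.prems] by (rule sums_unique[symmetric])
  moreover have "(\<Sum>n. x ^ n) = 1 / (1 - x)"
    using Suc.prems by (intro suminf_geometric) simp
  ultimately have "(\<lambda>n. real (Suc n choose Suc j) * x ^ n) sums (x ^ j / (1 - x) ^ (j + 2))"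
    by (simp add: mult.commute)
  then have "(\<lambda>n. x * (real (Suc n choose Suc j) * x ^ n)) sums (x * (x ^ j / (1 - x) ^ (j + 2)))"
    by (rule sums_mult)
  then have "(\<lambda>n. real (Suc n choose Suc j) * x ^ Suc n) sums (x ^ Suc j / (1 - x) ^ (Suc j + 1))"
    by (simp add: mult_ac)
  \<comment> \<open>The missing term at index 0 is zero, since
    \<open>0 choose Suc j = 0\<close>.\<close>
  then show ?case
    by (subst (asm) sums_Suc_iff) simp
qed

text \<open>The factor \<open>n\<close> is absorbed by writing \<open>n * (n choose j)\<close> as a
  combination of columns \<open>j\<close> and \<open>j + 1\<close>, whose sums are known.\<close>

lemma weighted_binomial_column_sums:
  fixes x :: real
  assumes "\<bar>x\<bar> < 1"
  shows "(\<lambda>n. real n * real (n choose j) * x ^ n) sums (x ^ j * (real j + x) / (1 - x) ^ (j + 2))"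
proof -
  have absorb: "real n * real (n choose j) = real j * real (n choose j) + real (j + 1) * real (n choose (j + 1))"
    for n
  proof -
    \<comment> \<open>Expanding the left side by Pascal's rule and cancelling one
      \<open>n choose j\<close> gives the absorption identity.\<close>
    have "real (Suc j) * real (Suc n choose Suc j) = real (Suc n) * real (n choose j)"
      by (simp only: Suc_times_binomial flip: of_nat_mult)
    then show ?thesis by (simp add: algebra_simps)
  qed
  have "(\<lambda>n. real j * (real (n choose j) * x ^ n) + real (j + 1) * (real (n choose (j + 1)) * x ^ n)) sums
      (real j * (x ^ j / (1 - x) ^ (j + 1)) + real (j + 1) * (x ^ (j + 1) / (1 - x) ^ (j + 1 + 1)))"
    by (intro sums_add sums_mult binomial_column_sums assms)
  moreover have "real j * (x ^ j / (1 - x) ^ (j + 1)) + real (j + 1) * (x ^ (j + 1) / (1 - x) ^ (j + 1 + 1)) =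
      x ^ j * (real j + x) / (1 - x) ^ (j + 2)"
  proof -
    have "x ^ j / (1 - x) ^ (j + 1) = x ^ j * (1 - x) / (1 - x) ^ (j + 2)"
      using assms by simp
    then show ?thesis by (simp only:) (simp add: algebra_simps flip: add_divide_distrib diff_divide_distrib)
  qed
  ultimately show ?thesis by (simp add: absorb algebra_simps)
qed

text \<open>In the half-sum and the half-difference of the two series every second term cancels, and
  dropping zero terms along a strictly increasing index map keeps the sum.\<close>

lemma sums_bisection:
  fixes x :: real
  assumes "(\<lambda>n. a n * x ^ n) sums A" and "(\<lambda>n. a n * (- x) ^ n) sums B"
  shows "(\<lambda>k. a (2 * k) * (x\<^sup>2) ^ k) sums ((A + B) / 2)"
    and "(\<lambda>k. a (2 * k + 1) * (x * (x\<^sup>2) ^ k)) sums ((A - B) / 2)"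
proof -
  let ?e = "\<lambda>n. (a n * x ^ n + a n * (- x) ^ n) / 2"
  let ?o = "\<lambda>n. (a n * x ^ n - a n * (- x) ^ n) / 2"
  have "?e sums ((A + B) / 2)" by (intro sums_divide sums_add assms)
  moreover have "(\<lambda>k. ?e (2 * k)) sums c \<longleftrightarrow> ?e sums c" for c
  proof (rule sums_mono_reindex)
    fix n assume "n \<notin> range (\<lambda>k. 2 * k :: nat)"
    then have "odd n" by (auto elim!: evenE)
    then show "?e n = 0" by simp
  qed (simp add: strict_mono_def)
  ultimately show "(\<lambda>k. a (2 * k) * (x\<^sup>2) ^ k) sums ((A + B) / 2)"
    by (simp add: power_mult)
  have "?o sums ((A - B) / 2)" by (intro sums_divide sums_diff assms)
  moreover have "(\<lambda>k. ?o (2 * k + 1)) sums c \<longleftrightarrow> ?o sums c" for c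
  proof (rule sums_mono_reindex)
    fix n assume "n \<notin> range (\<lambda>k. 2 * k + 1 :: nat)"
    then have "even n" by (metis oddE rangeI)
    then show "?o n = 0" by simp
  qed (simp add: strict_mono_def)
  moreover have "?o (2 * k + 1) = a (2 * k + 1) * (x * (x\<^sup>2) ^ k)" for k
    by (simp add: power_mult)
  ultimately show "(\<lambda>k. a (2 * k + 1) * (x * (x\<^sup>2) ^ k)) sums ((A - B) / 2)"
    by (simp only:)
qed

text \<open>For \<open>n = 2 * k\<close> the weight \<open>k\<close> is \<open>n / 2\<close>; this
  halving and the one from the bisection make the divisor 4. The term \<open>k = 0\<close> vanishes,
  so the sum may start at 1.\<close>

lemma weighted_even_binomial_sums:
  fixes x :: real
  assumes "\<bar>x\<bar> < 1"
  shows "(\<lambda>k. real (k + 1) * real ((2 * (k + 1)) choose j) * (x\<^sup>2) ^ (k + 1)) sums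
    ((x ^ j * (real j + x) / (1 - x) ^ (j + 2) + (- x) ^ j * (real j - x) / (1 + x) ^ (j + 2)) / 4)"
proof -
  have "\<bar>- x\<bar> < 1" using assms by simp
  note sums_bisection(1)[OF weighted_binomial_column_sums[OF assms]
      weighted_binomial_column_sums[OF this], of j]
  from sums_divide[OF this, of 2]
  have "(\<lambda>k. real k * real ((2 * k) choose j) * (x\<^sup>2) ^ k) sums
    ((x ^ j * (real j + x) / (1 - x) ^ (j + 2) + (- x) ^ j * (real j - x) / (1 + x) ^ (j + 2)) / 4)"
    by (simp add: mult.assoc)
  then show ?thesis
    unfolding Suc_eq_plus1[symmetric] by (subst sums_Suc_iff) simp
qed

text \<open>For \<open>n = 2 * k + 1\<close> the weight \<open>k\<close> is
  \<open>(n - 1) / 2\<close>, so the unweighted column sum is subtracted from the weighted one. The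
  odd power leaves a factor \<open>x\<close>, whose removal turns the divisor 4 into
  \<open>4 * x\<close>.\<close>

lemma weighted_odd_binomial_sums:
  fixes x :: real
  assumes "\<bar>x\<bar> < 1" "x \<noteq> 0"
  shows "(\<lambda>k. real (k + 1) * real ((2 * (k + 1) + 1) choose j) * (x\<^sup>2) ^ (k + 1)) sums
    ((x ^ j * (real j - 1 + 2 * x) / (1 - x) ^ (j + 2) -
      (- x) ^ j * (real j - 1 - 2 * x) / (1 + x) ^ (j + 2)) / (4 * x))"
proof -
  have column: "(\<lambda>n. (real n - 1) * real (n choose j) * y ^ n) sums
      (y ^ j * (real j - 1 + 2 * y) / (1 - y) ^ (j + 2))" if "\<bar>y\<bar> < 1" for y :: real
  proof -
    have "y ^ j * (real j + y) / (1 - y) ^ (j + 2) - y ^ j / (1 - y) ^ (j + 1) =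
        y ^ j * (real j - 1 + 2 * y) / (1 - y) ^ (j + 2)"
    proof -
      have "y ^ j / (1 - y) ^ (j + 1) = y ^ j * (1 - y) / (1 - y) ^ (j + 2)"
        using that by simp
      then show ?thesis by (simp only:) (simp add: algebra_simps flip: add_divide_distrib diff_divide_distrib)
    qed
    with sums_diff[OF weighted_binomial_column_sums[OF that] binomial_column_sums[OF that], of j j]
    show ?thesis by (simp add: algebra_simps)
  qed
  have "\<bar>- x\<bar> < 1" using assms by simp
  note sums_bisection(2)[OF column[OF assms(1)] column[OF this]]
  from sums_divide[OF this, of "2 * x"]
  have "(\<lambda>k. real k * real ((2 * k + 1) choose j) * (x\<^sup>2) ^ k) sums
    ((x ^ j * (real j - 1 + 2 * x) / (1 - x) ^ (j + 2) -
      (- x) ^ j * (real j - 1 - 2 * x) / (1 + x) ^ (j + 2)) / (4 * x))"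
    using assms(2) by (simp add: mult_ac)
  then show ?thesis
    unfolding Suc_eq_plus1[of "_ :: nat", symmetric] by (subst sums_Suc_iff) simp
qed

text \<open>Both bases are roots of \<open>t * t = 1 + t\<close>, so their powers obey the Lucas
  recurrence.\<close>

lemma lucas_closed_form:
  "real (lucas n) = ((1 + sqrt 5) / 2) ^ n + ((1 - sqrt 5) / 2) ^ n"
proof (induction n rule: lucas.induct)
  case (3 n)
  have sq: "((1 + sqrt 5) / 2) * ((1 + sqrt 5) / 2) = 1 + (1 + sqrt 5) / 2"
    "((1 - sqrt 5) / 2) * ((1 - sqrt 5) / 2) = 1 + (1 - sqrt 5) / 2"
    by (simp_all add: field_simps)
  have "((1 + sqrt 5) / 2) ^ Suc (Suc n) + ((1 - sqrt 5) / 2) ^ Suc (Suc n) =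
      ((1 + sqrt 5) / 2) ^ n * (((1 + sqrt 5) / 2) * ((1 + sqrt 5) / 2)) +
      ((1 - sqrt 5) / 2) ^ n * (((1 - sqrt 5) / 2) * ((1 - sqrt 5) / 2))"
    by (simp only: power_Suc mult_ac)
  also have "\<dots> = real (lucas (Suc n)) + real (lucas n)"
    unfolding sq 3 by (simp add: algebra_simps)
  finally show ?case by simp
qed (simp_all flip: add_divide_distrib)

theorem theorem6:
  fixes m :: nat
  shows "((\<lambda>k. real (k + 1) * real ((2 * (k + 1) + 1) choose (2 * m)) * (5 / 9) ^ (k + 1)) sums
      (9 / 16 * (5 / 4) ^ m *
        ((6 * real m + 3) * real (fib (4 * m + 4)) - 4 * real (fib (4 * m + 2)))))
      \<and> ((\<lambda>k. real (k + 1) * real ((2 * (k + 1) + 1) choose (2 * m + 1)) * (5 / 9) ^ (k + 1)) sums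
      (9 / 32 * (5 / 4) ^ m *
        ((6 * real m + 6) * real (lucas (4 * m + 6)) - 4 * real (lucas (4 * m + 4)))))
      \<and> ((\<lambda>k. real (k + 1) * real ((2 * (k + 1)) choose (2 * m)) * (5 / 9) ^ (k + 1)) sums
      (3 / 16 * (5 / 4) ^ m *
        ((6 * real m + 3) * real (lucas (4 * m + 4)) - 2 * real (lucas (4 * m + 2)))))
      \<and> ((\<lambda>k. real (k + 1) * real ((2 * (k + 1)) choose (2 * m + 1)) * (5 / 9) ^ (k + 1)) sums
      (15 / 16 * (5 / 4) ^ m *
        ((3 * real m + 3) * real (fib (4 * m + 6)) - real (fib (4 * m + 4)))))"
proof -
  define s where "s = sqrt 5"
  define x where "x = s / 3"
  define \<phi> where "\<phi> = (1 + s) / 2"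
  define \<psi> where "\<psi> = (1 - s) / 2"
  have s2: "s * s = 5" and "s > 0" by (simp_all add: s_def)
  have "s < 3" unfolding s_def by (rule real_less_lsqrt) simp_all
  have x: "\<bar>x\<bar> < 1" "x \<noteq> 0" using \<open>s > 0\<close> \<open>s < 3\<close> by (simp_all add: x_def)
  have x2: "x\<^sup>2 = 5 / 9" by (simp add: x_def power2_eq_square s2)
  have \<phi>2: "\<phi>\<^sup>2 = (3 + s) / 2" and \<psi>2: "\<psi>\<^sup>2 = (3 - s) / 2"
    by (simp_all add: \<phi>_def \<psi>_def power2_eq_square algebra_simps s2 add_divide_distrib diff_divide_distrib)
  have shift: "\<phi> ^ (n + 2) = \<phi> ^ n * ((3 + s) / 2)" "\<psi> ^ (n + 2) = \<psi> ^ n * ((3 - s) / 2)" for n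
    by (simp_all only: power_add \<phi>2 \<psi>2)
  have fib: "real (fib n) = (\<phi> ^ n - \<psi> ^ n) / s" for n
    using fib_closed_form[of n] by (simp add: \<phi>_def \<psi>_def s_def)
  have lucas: "real (lucas n) = \<phi> ^ n + \<psi> ^ n" for n
    using lucas_closed_form[of n] by (simp add: \<phi>_def \<psi>_def s_def)
  \<comment> \<open>Rationalise \<open>3 / (3 - s)\<close> and \<open>3 / (3 + s)\<close> using
    \<open>(3 - s) * (3 + s) = 4\<close>.\<close>
  have inv: "1 / (1 - x) = 3 / 2 * \<phi>\<^sup>2" "1 / (1 + x) = 3 / 2 * \<psi>\<^sup>2"
    using \<open>s > 0\<close> \<open>s < 3\<close> by (simp_all add: x_def \<phi>2 \<psi>2 field_simps s2)
  \<comment> \<open>Of the \<open>j + 2\<close> factors \<open>3 / 2\<close>, \<open>j\<close>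
    combine with the powers of \<open>x\<close> to powers of \<open>s / 2\<close>, and the other two
    give \<open>9 / 4\<close>.\<close>
  have pow: "x ^ j * c / (1 - x) ^ (j + 2) = 9 / 4 * (s / 2) ^ j * c * \<phi> ^ (2 * j + 4)"
    "(- x) ^ j * c / (1 + x) ^ (j + 2) = 9 / 4 * (- s / 2) ^ j * c * \<psi> ^ (2 * j + 4)" for j c
  proof -
    have const: "x * (3 / 2) = s / 2" "- x * (3 / 2) = - s / 2" "(3 / 2)\<^sup>2 = (9 / 4 :: real)"
      "2 * (j + 2) = 2 * j + 4"
      by (simp_all add: x_def power2_eq_square)
    have "x ^ j * c / (1 - x) ^ (j + 2) = x ^ j * c * (1 / (1 - x)) ^ (j + 2)"
      by (simp add: power_one_over)
    also have "\<dots> = (x * (3 / 2)) ^ j * (3 / 2)\<^sup>2 * c * \<phi> ^ (2 * (j + 2))"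
      unfolding inv power_mult power_mult_distrib by (simp only: power_add mult_ac)
    finally show "x ^ j * c / (1 - x) ^ (j + 2) = 9 / 4 * (s / 2) ^ j * c * \<phi> ^ (2 * j + 4)"
      unfolding const by (simp only: mult_ac)
    have "(- x) ^ j * c / (1 + x) ^ (j + 2) = (- x) ^ j * c * (1 / (1 + x)) ^ (j + 2)"
      by (simp add: power_one_over)
    also have "\<dots> = (- x * (3 / 2)) ^ j * (3 / 2)\<^sup>2 * c * \<psi> ^ (2 * (j + 2))"
      unfolding inv power_mult power_mult_distrib by (simp only: power_add mult_ac)
    finally show "(- x) ^ j * c / (1 + x) ^ (j + 2) = 9 / 4 * (- s / 2) ^ j * c * \<psi> ^ (2 * j + 4)"
      unfolding const by (simp only: mult_ac)
  qed
  have sq: "(s / 2)\<^sup>2 = 5 / 4" "(- s / 2)\<^sup>2 = 5 / 4"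
    by (simp_all add: power2_eq_square s2)
  \<comment> \<open>For odd exponents the leftover factor \<open>s / 2\<close> changes sign between
    the two conjugate terms. This swaps sums and differences of powers of \<phi> and \<psi>, and so
    Lucas and Fibonacci numbers.\<close>
  have half: "(s / 2) ^ (2 * m) = (5 / 4) ^ m" "(- s / 2) ^ (2 * m) = (5 / 4) ^ m"
    "(s / 2) ^ (2 * m + 1) = (5 / 4) ^ m * (s / 2)" "(- s / 2) ^ (2 * m + 1) = (5 / 4) ^ m * (- s / 2)"
    by (simp_all only: power_add power_mult sq power_one_right)
  note even = weighted_even_binomial_sums[OF x(1), unfolded pow x2]
  note odd = weighted_odd_binomial_sums[OF x, unfolded pow x2]
  \<comment> \<open>All indices that occur are \<open>4 * m + 2\<close> plus 0, 2 or 4, so with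
    \<open>p\<close>, \<open>q\<close> and \<open>t\<close> each limit identity becomes algebra in
    these, \<open>m\<close> and \<open>s\<close>, subject to \<open>s * s = 5\<close>.\<close>
  define p where "p = \<phi> ^ (4 * m + 2)"
  define q where "q = \<psi> ^ (4 * m + 2)"
  define t where "t = (5 / 4 :: real) ^ m"
  have split: "4 * m + 4 = 4 * m + 2 + 2" "4 * m + 6 = 4 * m + 2 + 2 + 2" by simp_all
  have p: "\<phi> ^ (4 * m + 2) = p" "\<phi> ^ (4 * m + 4) = p * ((3 + s) / 2)"
    "\<phi> ^ (4 * m + 6) = p * ((3 + s) / 2) * ((3 + s) / 2)"
    by (simp_all only: p_def split shift)
  have q: "\<psi> ^ (4 * m + 2) = q" "\<psi> ^ (4 * m + 4) = q * ((3 - s) / 2)"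
    "\<psi> ^ (4 * m + 6) = q * ((3 - s) / 2) * ((3 - s) / 2)"
    by (simp_all only: q_def split shift)
  have idx: "2 * (2 * m) + 4 = 4 * m + 4" "2 * (2 * m + 1) + 4 = 4 * m + 6" by simp_all
  note vals = half idx fib lucas p q x_def t_def[symmetric]
  \<comment> \<open>This variant of \<open>s2\<close> reduces squares of \<open>s\<close> inside
    right-nested products.\<close>
  have s3: "s * (s * y) = 5 * y" for y by (simp flip: mult.assoc add: s2)
  have "s \<noteq> 0" using \<open>s > 0\<close> by simp
  note alg = field_simps s2 s3
  show ?thesis
  proof (intro conjI)
    show "(\<lambda>k. real (k + 1) * real ((2 * (k + 1) + 1) choose (2 * m)) * (5 / 9) ^ (k + 1)) sums
      (9 / 16 * (5 / 4) ^ m *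
        ((6 * real m + 3) * real (fib (4 * m + 4)) - 4 * real (fib (4 * m + 2))))"
      \<comment> \<open>The series already agree, so \<open>back_subst\<close> leaves only the
        equality of the two limits.\<close>
      by (rule odd[of "2 * m", THEN back_subst[of "(sums) _"]],
          unfold vals) (use \<open>s \<noteq> 0\<close> in \<open>simp add: alg\<close>)
    show "(\<lambda>k. real (k + 1) * real ((2 * (k + 1) + 1) choose (2 * m + 1)) * (5 / 9) ^ (k + 1)) sums
      (9 / 32 * (5 / 4) ^ m *
        ((6 * real m + 6) * real (lucas (4 * m + 6)) - 4 * real (lucas (4 * m + 4))))"
      by (rule odd[of "2 * m + 1", THEN back_subst[of "(sums) _"]],
          unfold vals) (use \<open>s \<noteq> 0\<close> in \<open>simp add: alg\<close>)
    show "(\<lambda>k. real (k + 1) * real ((2 * (k + 1)) choose (2 * m)) * (5 / 9) ^ (k + 1)) sums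
      (3 / 16 * (5 / 4) ^ m *
        ((6 * real m + 3) * real (lucas (4 * m + 4)) - 2 * real (lucas (4 * m + 2))))"
      by (rule even[of "2 * m", THEN back_subst[of "(sums) _"]],
          unfold vals) (use \<open>s \<noteq> 0\<close> in \<open>simp add: alg\<close>)
    show "(\<lambda>k. real (k + 1) * real ((2 * (k + 1)) choose (2 * m + 1)) * (5 / 9) ^ (k + 1)) sums
      (15 / 16 * (5 / 4) ^ m *
        ((3 * real m + 3) * real (fib (4 * m + 6)) - real (fib (4 * m + 4))))"
      by (rule even[of "2 * m + 1", THEN back_subst[of "(sums) _"]],
          unfold vals) (use \<open>s \<noteq> 0\<close> in \<open>simp add: alg\<close>)
  qed
qed

end
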